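(* $\mathsf{tJ}(\mathsf{C}_{2^{\mathbb{N}}})\equiv_{\mathrm W}\mathsf{T}(\mathsf{C}_{2^{\mathbb{N}}}\times\mathsf{W})$.
   Context: A problem is a partial multi-valued function $f:\subseteq\mathbb{N}^{\mathbb{N}}\rightrightarrows\mathbb{N}^{\mathbb{N}}$, with $\mathrm{dom}(f)=\{p: f(p)\ne\emptyset\}$. $f\le_{\mathrm W} g$ means there are partial computable functionals $\Phi:\subseteq\mathbb{N}^{\mathbb{N}}\to\mathbb{N}^{\mathbb{N}}$ and $\Psi:\subseteq\mathbb{N}^{\mathbb{N}}\times\mathbb{N}^{\mathbb{N}}\to\mathbb{N}^{\mathbb{N}}$ such that for every $p\in\mathrm{dom}(f)$: $\Phi(p)\in\mathrm{dom}(g)$ and $\Psi(p,q)\in f(p)$ for every $q\in g(\Phi(p))$. $f\equiv_{\mathrm W} g$ means $f\le_{\mathrm W} g$ and $g\le_{\mathrm W} f$. Finite products of copies of $\mathbb{N}$ and $\mathbb{N}^{\mathbb{N}}$ are identified with $\mathbb{N}^{\mathbb{N}}$ via standard computable codings. $(\Phi_e)_{e\in\mathbb{N}}$ is a fixed standard computable enumeration of the partial computable functionals on $\mathbb{N}^{\mathbb{N}}$; $\Phi_i(p,q)$ means $\Phi_i$ applied to the pair $(p,q)$; $\downarrow$ means defined. Tot-jump: for $e,i\in\mathbb{N}$, $p\in\mathbb{N}^{\mathbb{N}}$, $\mathsf{tJ}(f)(e,i,p)=\{\Phi_i(p,q): q\in f(\Phi_e(p))\}$ if $\Phi_e(p)\in\mathrm{dom}(f)$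 and $\Phi_i(p,q)\downarrow$ for all $q\in f(\Phi_e(p))$; otherwise $\mathsf{tJ}(f)(e,i,p)=\mathbb{N}^{\mathbb{N}}$. Totalization: $\mathsf{T}f(x)=f(x)$ if $x\in\mathrm{dom}(f)$ and $\mathsf{T}f(x)=\mathbb{N}^{\mathbb{N}}$ otherwise. Parallel product: $(f\times g)(x,y)=f(x)\times g(y)$, with domain $\mathrm{dom}(f)\times\mathrm{dom}(g)$. $\mathsf{C}_{2^{\mathbb{N}}}$, regarded as a problem on Baire space: given the characteristic function (via a fixed computable coding of finite strings by natural numbers) of an infinite subtree of $2^{<\mathbb{N}}$, find an infinite path through it. $\mathsf{W}(p)=\{q\in\mathbb{N}^{\mathbb{N}}: (\forall i)\,q(i+1)>q(i)\text{ and }p\circ q=0^{\mathbb{N}}\}$, so that $\mathrm{dom}(\mathsf{W})$ is the set of $p$ with infinitely many zeroes. *)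

theory Defs
  imports Main "HOL-Library.Nat_Bijection" "HOL-Library.Sublist"
begin

type_synonym baire = "nat \<Rightarrow> nat"

section \<open>Partial computable functionals on Baire space\<close>

text \<open>
  Kleene's schemata relative to an oracle, in unary form: several arguments are combined by
  the Cantor pairing function \<^const>\<open>prod_encode\<close>. The identity is \<open>Pair Fst Snd\<close>.
\<close>

datatype prog =
    Zero
  | Succ
  | Fst
  | Snd
  | Oracle
  | Comp prog prog
  | Pair prog prog
  | Prec prog prog
  | Mu prog

text \<open>
  \<open>eval p c x\<close> is the value, if any, of the program \<open>c\<close> with oracle \<open>p\<close> at \<open>x\<close>.
  Application is strict. \<open>Prec f g\<close> computes \<open>h\<close> with \<open>h(a, 0) = f(a)\<close> and
  \<open>h(a, n + 1) = g(a, (n, h(a, n)))\<close>. \<open>Mu f\<close> is unbounded search: it returns the least \<open>n\<close> with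
  \<open>f(x, n) = 0\<close>, provided that \<open>f(x, m)\<close> is defined for all smaller \<open>m\<close>.
\<close>

primrec eval :: "baire \<Rightarrow> prog \<Rightarrow> nat \<Rightarrow> nat option" where
  "eval p Zero x = Some 0"
| "eval p Succ x = Some (Suc x)"
| "eval p Fst x = Some (fst (prod_decode x))"
| "eval p Snd x = Some (snd (prod_decode x))"
| "eval p Oracle x = Some (p x)"
| "eval p (Comp f g) x = Option.bind (eval p g x) (eval p f)"
| "eval p (Pair f g) x =
     Option.bind (eval p f x) (\<lambda>y. Option.bind (eval p g x) (\<lambda>z. Some (prod_encode (y, z))))"
| "eval p (Prec f g) x =
     (case prod_decode x of (a, n) \<Rightarrow>
        rec_nat (eval p f a)
          (\<lambda>m r. Option.bind r (\<lambda>v. eval p g (prod_encode (a, prod_encode (m, v))))) n)"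
| "eval p (Mu f) x =
     (if \<exists>n. eval p f (prod_encode (x, n)) = Some 0 \<and>
             (\<forall>m<n. eval p f (prod_encode (x, m)) \<noteq> None)
      then Some (LEAST n. eval p f (prod_encode (x, n)) = Some 0)
      else None)"

text \<open>A bijective Goedel numbering of programs.\<close>

primrec prog_encode :: "prog \<Rightarrow> nat" where
  "prog_encode Zero = 0"
| "prog_encode Succ = 1"
| "prog_encode Fst = 2"
| "prog_encode Snd = 3"
| "prog_encode Oracle = 4"
| "prog_encode (Comp f g) = 5 + 4 * prod_encode (prog_encode f, prog_encode g)"
| "prog_encode (Pair f g) = 6 + 4 * prod_encode (prog_encode f, prog_encode g)"
| "prog_encode (Prec f g) = 7 + 4 * prod_encode (prog_encode f, prog_encode g)"
| "prog_encode (Mu f) = 8 + 4 * prog_encode f"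

lemma inj_prog_encode: "inj prog_encode"
proof (rule injI)
  show "prog_encode c = prog_encode d \<Longrightarrow> c = d" for c d
    by (induction c arbitrary: d; case_tac d; simp; presburger)
qed

lemma surj_prog_encode: "surj prog_encode"
proof -
  have "n \<in> range prog_encode" for n
  proof (induction n rule: less_induct)
    case (less n)
    show ?case
    proof (cases "n < 5")
      case True
      then have "n = 0 \<or> n = 1 \<or> n = 2 \<or> n = 3 \<or> n = 4" by arith
      then show ?thesis
        by (metis prog_encode.simps(1-5) rangeI)
    next
      case False
      define k where "k = (n - 5) div 4"
      obtain a b where k: "k = prod_encode (a, b)"
        by (metis prod.exhaust prod_decode_inverse)
      have lt: "k < n" "a < n" "b < n"
        using False le_prod_encode_1[of a b] le_prod_encode_2[of b a]
        by (auto simp: k_def k[symmetric])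
      then obtain f g h where fgh: "prog_encode f = a" "prog_encode g = b" "prog_encode h = k"
        using less.IH by (metis imageE)
      have "(n - 5) mod 4 < 4" by simp
      then have "n = 5 + 4 * k \<or> n = 6 + 4 * k \<or> n = 7 + 4 * k \<or> n = 8 + 4 * k"
        using False unfolding k_def by presburger
      then have "n = prog_encode (Comp f g) \<or> n = prog_encode (Pair f g) \<or>
          n = prog_encode (Prec f g) \<or> n = prog_encode (Mu h)"
        by (simp add: fgh k)
      then show ?thesis by blast
    qed
  qed
  then show ?thesis by blast
qed

lemma bij_prog_encode: "bij prog_encode"
  by (rule bijI[OF inj_prog_encode surj_prog_encode])

definition prog_decode :: "nat \<Rightarrow> prog" where
  "prog_decode = inv prog_encode"

text \<open>
  \<open>Phi e\<close> is defined at \<open>p\<close> iff the \<open>e\<close>-th program with oracle \<open>p\<close> halts on every input.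
\<close>

definition Phi :: "nat \<Rightarrow> baire \<Rightarrow> baire option" where
  "Phi e p =
     (if \<forall>n. eval p (prog_decode e) n \<noteq> None
      then Some (\<lambda>n. the (eval p (prog_decode e) n))
      else None)"

definition computable :: "(baire \<Rightarrow> baire option) \<Rightarrow> bool" where
  "computable F \<longleftrightarrow> (\<exists>e. F = Phi e)"


section \<open>Codings of products\<close>

definition bpair :: "baire \<Rightarrow> baire \<Rightarrow> baire" where
  "bpair p q = (\<lambda>n. if even n then p (n div 2) else q (n div 2))"

definition bfst :: "baire \<Rightarrow> baire" where
  "bfst r = (\<lambda>n. r (2 * n))"

definition bsnd :: "baire \<Rightarrow> baire" where
  "bsnd r = (\<lambda>n. r (2 * n + 1))"

lemma bfst_bpair [simp]: "bfst (bpair p q) = p"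
  by (simp add: bfst_def bpair_def)

lemma bsnd_bpair [simp]: "bsnd (bpair p q) = q"
  by (simp add: bsnd_def bpair_def)

lemma bpair_bfst_bsnd [simp]: "bpair (bfst r) (bsnd r) = r"
  by (rule ext) (simp add: bfst_def bsnd_def bpair_def)

text \<open>The triple \<open>(e, i, p)\<close> is coded by the sequence \<open>e, i, p 0, p 1, \<dots>\<close>.\<close>

definition triple :: "nat \<Rightarrow> nat \<Rightarrow> baire \<Rightarrow> baire" where
  "triple e i p = case_nat e (case_nat i p)"

lemma triple_surj: "triple (r 0) (r 1) (\<lambda>n. r (n + 2)) = r"
  by (rule ext) (simp add: triple_def split: nat.split)


section \<open>Problems and Weihrauch reducibility\<close>

text \<open>A partial multi-valued function is a set-valued function, undefined where it is empty.\<close>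

type_synonym problem = "baire \<Rightarrow> baire set"

definition pdom :: "problem \<Rightarrow> baire set" where
  "pdom f = {p. f p \<noteq> {}}"

definition weihrauch_le :: "problem \<Rightarrow> problem \<Rightarrow> bool"  (infix "\<le>\<^sub>W" 50) where
  "f \<le>\<^sub>W g \<longleftrightarrow>
     (\<exists>F G. computable F \<and> computable G \<and>
        (\<forall>p\<in>pdom f. \<exists>x\<in>pdom g. F p = Some x \<and>
           (\<forall>q\<in>g x. \<exists>y\<in>f p. G (bpair p q) = Some y)))"

definition weihrauch_equiv :: "problem \<Rightarrow> problem \<Rightarrow> bool"  (infix "\<equiv>\<^sub>W" 50) where
  "f \<equiv>\<^sub>W g \<longleftrightarrow> f \<le>\<^sub>W g \<and> g \<le>\<^sub>W f"

definition tot_jump :: "problem \<Rightarrow> problem" where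
  "tot_jump f r =
     (let e = r 0; i = r 1; p = (\<lambda>n. r (n + 2)) in
      case Phi e p of
        None \<Rightarrow> UNIV
      | Some x \<Rightarrow>
          if x \<in> pdom f \<and> (\<forall>q\<in>f x. Phi i (bpair p q) \<noteq> None)
          then {y. \<exists>q\<in>f x. Phi i (bpair p q) = Some y}
          else UNIV)"

lemma tot_jump_triple:
  "tot_jump f (triple e i p) =
     (case Phi e p of
        None \<Rightarrow> UNIV
      | Some x \<Rightarrow>
          if x \<in> pdom f \<and> (\<forall>q\<in>f x. Phi i (bpair p q) \<noteq> None)
          then {y. \<exists>q\<in>f x. Phi i (bpair p q) = Some y}
          else UNIV)"
  by (simp add: tot_jump_def triple_def)

definition totalization :: "problem \<Rightarrow> problem" where
  "totalization f p = (if p \<in> pdom f then f p else UNIV)"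

definition parallel :: "problem \<Rightarrow> problem \<Rightarrow> problem"  (infixr "\<times>\<^sub>W" 70) where
  "(f \<times>\<^sub>W g) r = {bpair a b | a b. a \<in> f (bfst r) \<and> b \<in> g (bsnd r)}"

lemma bpair_mem_pdom_parallel: "bpair p q \<in> pdom (f \<times>\<^sub>W g) \<longleftrightarrow> p \<in> pdom f \<and> q \<in> pdom g"
  by (auto simp: pdom_def parallel_def)


section \<open>The problems \<open>C\<close> on Cantor space and \<open>W\<close>\<close>

definition binary_tree :: "nat list set \<Rightarrow> bool" where
  "binary_tree T \<longleftrightarrow>
     (\<forall>s\<in>T. set s \<subseteq> {0, 1}) \<and> (\<forall>s\<in>T. \<forall>t. prefix t s \<longrightarrow> t \<in> T)"

definition char_fun :: "nat list set \<Rightarrow> baire" where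
  "char_fun T = (\<lambda>n. if list_decode n \<in> T then 1 else 0)"

definition infinite_path :: "nat list set \<Rightarrow> baire \<Rightarrow> bool" where
  "infinite_path T q \<longleftrightarrow> (\<forall>n. map q [0..<n] \<in> T)"

definition C_Cantor :: problem where
  "C_Cantor p =
     {q. \<exists>T. binary_tree T \<and> infinite T \<and> p = char_fun T \<and> infinite_path T q}"

definition W_problem :: problem where
  "W_problem p = {q. (\<forall>i. q (i + 1) > q i) \<and> p \<circ> q = (\<lambda>_. 0)}"

end

theory Submission
  imports Defs "HOL-Library.Infinite_Set"
begin

text \<open>
  The tot-jump of \<^const>\<open>C_Cantor\<close> at \<open>(e, i, p)\<close> is restrictive only if \<open>Phi e p\<close> is an infinite binary
  tree and \<open>Phi i (p, q)\<close> is defined for all its paths \<open>q\<close>. The main point is that, because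
  Cantor space is compact, the second condition can be observed from below although it quantifies
  over all paths: for each \<open>n\<close> there is a level of the tree at which every node determines the
  \<open>n\<close>-th value of the result (\<open>ex_covered\<close>). Thus there is a sequence, computable from
  \<open>(e, i, p)\<close>, that has infinitely many zeros under this hypothesis (\<open>infinite_signal\<close>), and from
  an increasing enumeration \<open>w\<close> of zeros one can read a number of stages \<open>w n\<close> that suffices for
  the \<open>n\<close>-th value (\<open>W_problem_signal\<close>). The tree itself is replaced by \<open>approx_tree\<close>, which
  is computable even if \<open>Phi e p\<close> is partial and has the same paths in the relevant case
  (\<open>subset_approx_tree\<close>, \<open>infinite_path_approx_tree\<close>). A solution \<open>(q, w)\<close> then yields \<open>Phi i (p, q)\<close>
  by running the computation for its \<open>n\<close>-th value through \<open>w n\<close> stages. This bounded evaluation never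
  diverges, as is needed when the totalized problem returns an arbitrary answer.

  For the converse, \<open>e\<close> selects the tree from an instance of the product and \<open>i\<close> pairs a path with the
  sequence of zeros found by search. The tot-jump takes care of the instances for which the tree
  is not valid or the search fails.

  Since \<open>e\<close> and \<open>i\<close> are part of the input, the first reduction uses a universal machine with bounded
  running time. It is given by a sequence of finite sets of derived outcomes \<open>(c, x, v)\<close>, meaning that
  program \<open>c\<close> yields \<open>v\<close> at \<open>x\<close>. Each stage adds at most one outcome that follows from the earlier ones
  in one step; this is sound and complete (\<open>halts_iff_eval\<close>), and stage \<open>s\<close> only
  depends on the oracle below \<open>s\<close> (\<open>halts_cong\<close>). A small calculus of closure rules for computable
  functions shows that these objects are computable.
\<close>

section \<open>Functions computable on a set of oracles\<close>

abbreviation pfst :: "nat \<Rightarrow> nat" where "pfst n \<equiv> fst (prod_decode n)"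
abbreviation psnd :: "nat \<Rightarrow> nat" where "psnd n \<equiv> snd (prod_decode n)"

text \<open>
  The set \<open>A\<close> consists of the oracles for which a program is guaranteed to halt everywhere. An
  unbounded search is admissible as soon as it succeeds for all oracles in \<open>A\<close>, and nothing is
  claimed about other oracles. The argument \<open>x\<close> codes a whole environment: the rules below
  introduce a bound variable by extending \<open>x\<close> to \<open>prod_encode (x, n)\<close>, so that the computability of
  an explicit term follows by resolution alone.
\<close>

definition rec_on :: "baire set \<Rightarrow> (baire \<Rightarrow> nat \<Rightarrow> nat) \<Rightarrow> bool" where
  "rec_on A f \<longleftrightarrow> (\<exists>c. \<forall>p\<in>A. \<forall>x. eval p c x = Some (f p x))"

definition dec_on :: "baire set \<Rightarrow> (baire \<Rightarrow> nat \<Rightarrow> bool) \<Rightarrow> bool" where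
  "dec_on A P \<longleftrightarrow> rec_on A (\<lambda>p x. of_bool (P p x))"

named_theorems rec_intros

lemma rec_id [rec_intros]: "rec_on A (\<lambda>p x. x)"
  unfolding rec_on_def by (rule exI[of _ "Pair Fst Snd"]) simp

lemma rec_comp:
  assumes "rec_on A f" "rec_on A g"
  shows "rec_on A (\<lambda>p x. f p (g p x))"
proof -
  obtain c d where "\<forall>p\<in>A. \<forall>x. eval p c x = Some (f p x)" "\<forall>p\<in>A. \<forall>x. eval p d x = Some (g p x)"
    using assms unfolding rec_on_def by blast
  then show ?thesis unfolding rec_on_def by (intro exI[of _ "Comp c d"]) simp
qed

lemma rec_Suc [rec_intros]: "rec_on A f \<Longrightarrow> rec_on A (\<lambda>p x. Suc (f p x))"
  by (rule rec_comp[where f = "\<lambda>p x. Suc x"]) (auto simp: rec_on_def intro: exI[of _ Succ])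

lemma rec_const [rec_intros]: "rec_on A (\<lambda>p x. k)"
proof (induction k)
  case 0
  show ?case unfolding rec_on_def by (rule exI[of _ Zero]) simp
qed (rule rec_Suc)

lemma rec_oracle [rec_intros]: "rec_on A f \<Longrightarrow> rec_on A (\<lambda>p x. p (f p x))"
  by (rule rec_comp[where f = "\<lambda>p x. p x"]) (auto simp: rec_on_def intro: exI[of _ Oracle])

lemma rec_pfst [rec_intros]: "rec_on A f \<Longrightarrow> rec_on A (\<lambda>p x. pfst (f p x))"
  by (rule rec_comp[where f = "\<lambda>p x. pfst x"]) (auto simp: rec_on_def intro: exI[of _ Fst])

lemma rec_psnd [rec_intros]: "rec_on A f \<Longrightarrow> rec_on A (\<lambda>p x. psnd (f p x))"
  by (rule rec_comp[where f = "\<lambda>p x. psnd x"]) (auto simp: rec_on_def intro: exI[of _ Snd])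

lemma rec_prod_encode [rec_intros]:
  assumes "rec_on A f" "rec_on A g"
  shows "rec_on A (\<lambda>p x. prod_encode (f p x, g p x))"
proof -
  obtain c d where "\<forall>p\<in>A. \<forall>x. eval p c x = Some (f p x)" "\<forall>p\<in>A. \<forall>x. eval p d x = Some (g p x)"
    using assms unfolding rec_on_def by blast
  then show ?thesis unfolding rec_on_def by (intro exI[of _ "Pair c d"]) simp
qed

text \<open>
  The step function may mention the environment \<open>x\<close>, the counter and the previous value; its
  premise reads the three off from the code \<open>z = (x, (m, v))\<close> on which \<^const>\<open>Prec\<close> runs its second
  program.
\<close>

lemma rec_rec_nat [rec_intros]:
  assumes "rec_on A f"
    and "rec_on A (\<lambda>p z. G p (pfst z) (pfst (psnd z)) (psnd (psnd z)))"
    and "rec_on A n"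
  shows "rec_on A (\<lambda>p x. rec_nat (f p x) (G p x) (n p x))"
proof -
  obtain c d where c: "\<forall>p\<in>A. \<forall>x. eval p c x = Some (f p x)"
    and d: "\<forall>p\<in>A. \<forall>z. eval p d z = Some (G p (pfst z) (pfst (psnd z)) (psnd (psnd z)))"
    using assms(1,2) unfolding rec_on_def by blast
  have "eval p (Prec c d) (prod_encode (x, k)) = Some (rec_nat (f p x) (G p x) k)"
    if "p \<in> A" for p x k
    using that c d by (induction k) auto
  then have "eval p (Prec c d) z = Some (rec_nat (f p (pfst z)) (G p (pfst z)) (psnd z))"
    if "p \<in> A" for p z
    using that by (metis prod.collapse prod_decode_inverse)
  then have "rec_on A (\<lambda>p z. rec_nat (f p (pfst z)) (G p (pfst z)) (psnd z))"
    unfolding rec_on_def by blast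
  then have "rec_on A (\<lambda>p x. (\<lambda>p z. rec_nat (f p (pfst z)) (G p (pfst z)) (psnd z)) p
      (prod_encode (x, n p x)))"
    by (rule rec_comp) (intro rec_intros assms)
  then show ?thesis by simp
qed

lemma rec_of_bool [rec_intros]: "dec_on A P \<Longrightarrow> rec_on A (\<lambda>p x. of_bool (P p x))"
  by (simp add: dec_on_def)

lemma rec_if [rec_intros]:
  assumes "dec_on A P" "rec_on A f" "rec_on A g"
  shows "rec_on A (\<lambda>p x. if P p x then f p x else g p x)"
proof -
  have "rec_on A (\<lambda>p x. rec_nat (g p x) (\<lambda>_ _. f p x) (of_bool (P p x)))"
    by (intro rec_intros assms rec_comp[OF assms(2)])
  moreover have "rec_nat (g p x) (\<lambda>_ _. f p x) (of_bool (P p x)) = (if P p x then f p x else g p x)"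
    for p x by simp
  ultimately show ?thesis by simp
qed

lemma dec_if [rec_intros]:
  assumes "dec_on A P" "dec_on A Q" "dec_on A R"
  shows "dec_on A (\<lambda>p x. if P p x then Q p x else R p x)"
proof -
  have "rec_on A (\<lambda>p x. if P p x then of_bool (Q p x) else of_bool (R p x))"
    by (intro rec_intros assms)
  then show ?thesis by (simp only: dec_on_def if_distrib[of of_bool])
qed

lemma dec_const [rec_intros]: "dec_on A (\<lambda>p x. b)"
  unfolding dec_on_def by (rule rec_const)

lemma dec_not [rec_intros]:
  assumes "dec_on A P"
  shows "dec_on A (\<lambda>p x. \<not> P p x)"
proof -
  have "dec_on A (\<lambda>p x. if P p x then False else True)"
    by (intro rec_intros assms)
  then show ?thesis by (simp only: if_False if_True if_bool_eq_conj simp_thms)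
qed

lemma dec_conj [rec_intros]:
  assumes "dec_on A P" "dec_on A Q"
  shows "dec_on A (\<lambda>p x. P p x \<and> Q p x)"
proof -
  have "dec_on A (\<lambda>p x. if P p x then Q p x else False)"
    by (intro rec_intros assms)
  moreover have "(if a then b else False) \<longleftrightarrow> a \<and> b" for a b by simp
  ultimately show ?thesis by (simp only:)
qed

lemma dec_disj [rec_intros]:
  assumes "dec_on A P" "dec_on A Q"
  shows "dec_on A (\<lambda>p x. P p x \<or> Q p x)"
proof -
  have "dec_on A (\<lambda>p x. if P p x then True else Q p x)"
    by (intro rec_intros assms)
  moreover have "(if a then True else b) \<longleftrightarrow> a \<or> b" for a b by simp
  ultimately show ?thesis by (simp only:)
qed

lemma dec_imp [rec_intros]:
  "dec_on A P \<Longrightarrow> dec_on A Q \<Longrightarrow> dec_on A (\<lambda>p x. P p x \<longrightarrow> Q p x)"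
  unfolding imp_conv_disj by (intro rec_intros)

lemma rec_add [rec_intros]: 
  assumes "rec_on A f" "rec_on A g"
  shows "rec_on A (\<lambda>p x. f p x + g p x)"
proof -
  have "rec_on A (\<lambda>p x. rec_nat (f p x) (\<lambda>_ v. Suc v) (g p x))"
    by (intro rec_intros assms)
  moreover have "rec_nat a (\<lambda>_ v. Suc v) b = a + b" for a b :: nat
    by (induction b) auto
  ultimately show ?thesis by simp
qed

lemma rec_mult [rec_intros]: 
  assumes "rec_on A f" "rec_on A g"
  shows "rec_on A (\<lambda>p x. f p x * g p x)"
proof -
  have "rec_on A (\<lambda>p x. rec_nat 0 (\<lambda>_ v. v + f p x) (g p x))"
    by (intro rec_intros assms rec_comp[OF assms(1)])
  moreover have "rec_nat 0 (\<lambda>_ v. v + a) b = a * b" for a b :: nat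
    by (induction b) auto
  ultimately show ?thesis by simp
qed

lemma rec_diff [rec_intros]: 
  assumes "rec_on A f" "rec_on A g"
  shows "rec_on A (\<lambda>p x. f p x - g p x)"
proof -
  have pred: "rec_on A (\<lambda>p x. h p x - 1)" if "rec_on A h" for h
  proof -
    have "rec_on A (\<lambda>p x. rec_nat 0 (\<lambda>m _. m) (h p x))"
      by (intro rec_intros that)
    moreover have "rec_nat 0 (\<lambda>m _. m) b = b - 1" for b :: nat
      by (cases b) auto
    ultimately show ?thesis by simp
  qed
  have "rec_on A (\<lambda>p x. rec_nat (f p x) (\<lambda>_ v. v - 1) (g p x))"
    by (intro rec_intros assms pred)
  moreover have "rec_nat a (\<lambda>_ v. v - 1) b = a - b" for a b :: nat
    by (induction b) auto
  ultimately show ?thesis by simp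
qed

lemma dec_less [rec_intros]:
  assumes "rec_on A f" "rec_on A g"
  shows "dec_on A (\<lambda>p x. f p x < g p x)"
proof -
  have "rec_on A (\<lambda>p x. rec_nat 0 (\<lambda>_ _. 1) (g p x - f p x))"
    by (intro rec_intros assms)
  moreover have "rec_nat 0 (\<lambda>_ _. 1) (b - a) = (of_bool (a < b) :: nat)" for a b :: nat
    by (cases "b - a") auto
  ultimately show ?thesis by (simp only: dec_on_def)
qed

lemma dec_le [rec_intros]:
  "rec_on A f \<Longrightarrow> rec_on A g \<Longrightarrow> dec_on A (\<lambda>p x. f p x \<le> g p x)"
  using dec_not[OF dec_less, of A g f] by (simp add: not_less)

lemma dec_eq [rec_intros]:
  "rec_on A f \<Longrightarrow> rec_on A g \<Longrightarrow> dec_on A (\<lambda>p x. f p x = g p x)"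
  using dec_conj[OF dec_le dec_le, of A f g g f] by (simp add: eq_iff)

lemma rec_Least [rec_intros]:
  assumes "dec_on A (\<lambda>p z. P p (pfst z) (psnd z))"
    and ex: "\<And>p x. p \<in> A \<Longrightarrow> \<exists>n. P p x n"
  shows "rec_on A (\<lambda>p x. LEAST n. P p x n)"
proof -
  obtain c where c: "\<forall>p\<in>A. \<forall>z. eval p c z = Some (of_bool (\<not> P p (pfst z) (psnd z)))"
    using dec_not[OF assms(1)] unfolding dec_on_def rec_on_def by blast
  have "eval p (Mu c) x = Some (LEAST n. P p x n)" if "p \<in> A" for p x
    using c that ex[OF that, of x] by simp
  then show ?thesis unfolding rec_on_def by blast
qed

text \<open>
  A bounded quantifier is an unbounded search for \<open>n\<close> that also stops at the bound, hence always
  succeeds.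
\<close>

lemma dec_bex [rec_intros]:
  assumes "rec_on A b" "dec_on A (\<lambda>p z. P p (pfst z) (psnd z))"
  shows "dec_on A (\<lambda>p x. \<exists>n<b p x. P p x n)"
proof -
  have "dec_on A (\<lambda>p x. (LEAST n. n = b p x \<or> P p x n) < b p x)"
    by (intro rec_intros assms rec_comp[OF assms(1)]) auto
  moreover have "(LEAST n. n = k \<or> Q n) < k \<longleftrightarrow> (\<exists>n<k. Q n)" for k :: nat and Q
    by (smt (verit) LeastI_ex Least_le linorder_not_less nat_neq_iff order.strict_trans1)
  ultimately show ?thesis by simp
qed

lemma dec_ball [rec_intros]:
  assumes "rec_on A b" "dec_on A (\<lambda>p z. P p (pfst z) (psnd z))"
  shows "dec_on A (\<lambda>p x. \<forall>n<b p x. P p x n)"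
  using dec_not[OF dec_bex[OF assms(1) dec_not[OF assms(2)]]] by simp

lemma rec_div2 [rec_intros]:
  assumes "rec_on A f"
  shows "rec_on A (\<lambda>p x. f p x div 2)"
proof -
  have "rec_on A (\<lambda>p x. LEAST k. f p x < 2 * k + 2)"
    by (intro rec_intros rec_comp[OF assms]) presburger
  moreover have "(LEAST k. n < 2 * k + 2) = n div 2" for n :: nat
    by (rule Least_equality) auto
  ultimately show ?thesis by simp
qed

lemma dec_even [rec_intros]:
  assumes "rec_on A f"
  shows "dec_on A (\<lambda>p x. even (f p x))"
proof -
  have "dec_on A (\<lambda>p x. 2 * (f p x div 2) = f p x)"
    by (intro rec_intros assms)
  moreover have "2 * (n div 2) = n \<longleftrightarrow> even n" for n :: nat
    by (metis dvd_mult_div_cancel dvd_triv_left)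
  ultimately show ?thesis by simp
qed

subsection \<open>Codes of finite lists\<close>

text \<open>
  \<open>drop_code\<close> and \<open>entry\<close> act on codes as \<^const>\<open>drop\<close> and indexing act on lists. Since \<open>0\<close> decodes
  to the pair \<open>(0, 0)\<close>, an index beyond the end of the list yields \<open>0\<close>.
\<close>

definition drop_code :: "nat \<Rightarrow> nat \<Rightarrow> nat" where
  "drop_code u n = rec_nat u (\<lambda>_ v. psnd (v - 1)) n"

definition entry :: "nat \<Rightarrow> nat \<Rightarrow> nat" where
  "entry u k = pfst (drop_code u k - 1)"

lemma prod_decode_0 [simp]: "prod_decode 0 = (0, 0)"
  by (simp add: prod_decode_def prod_decode_aux.simps)

lemma list_decode_tl: "list_decode (psnd (v - 1)) = tl (list_decode v)"
  by (cases v) (auto split: prod.split)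

lemma list_decode_hd: "v \<noteq> 0 \<Longrightarrow> pfst (v - 1) = hd (list_decode v)"
  by (cases v) (auto split: prod.split)

lemma list_decode_eq_Nil: "list_decode v = [] \<longleftrightarrow> v = 0"
  by (cases v) (auto split: prod.split)

lemma list_decode_drop_code: "list_decode (drop_code u n) = drop n (list_decode u)"
  unfolding drop_code_def by (induction n) (auto simp: list_decode_tl[simplified] drop_Suc tl_drop)

lemma drop_code_eq_0: "drop_code u n = 0 \<longleftrightarrow> length (list_decode u) \<le> n"
  by (metis drop_eq_Nil list_decode_drop_code list_decode_eq_Nil)

lemma entry_eq: "entry u k = (if k < length (list_decode u) then list_decode u ! k else 0)"
proof (cases "k < length (list_decode u)")
  case True
  then show ?thesis
    using list_decode_hd[of "drop_code u k"]
    by (simp add: entry_def drop_code_eq_0 list_decode_drop_code hd_drop_conv_nth)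
next
  case False
  then show ?thesis using drop_code_eq_0[of u k] by (simp add: entry_def)
qed

lemma rec_drop_code [rec_intros]:
  "rec_on A f \<Longrightarrow> rec_on A g \<Longrightarrow> rec_on A (\<lambda>p x. drop_code (f p x) (g p x))"
  unfolding drop_code_def by (intro rec_intros)

lemma rec_entry [rec_intros]:
  "rec_on A f \<Longrightarrow> rec_on A g \<Longrightarrow> rec_on A (\<lambda>p x. entry (f p x) (g p x))"
  unfolding entry_def by (intro rec_intros)

lemma rec_length [rec_intros]:
  assumes "rec_on A f"
  shows "rec_on A (\<lambda>p x. length (list_decode (f p x)))"
proof -
  have "rec_on A (\<lambda>p x. LEAST n. drop_code (f p x) n = 0)"
    by (intro rec_intros rec_comp[OF assms]) (auto simp: drop_code_eq_0)
  moreover have "(LEAST n. k \<le> n) = k" for k :: nat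
    by (rule Least_equality) auto
  ultimately show ?thesis by (simp add: drop_code_eq_0)
qed

lemma dec_member [rec_intros]:
  assumes "rec_on A f" "rec_on A g"
  shows "dec_on A (\<lambda>p x. f p x \<in> set (list_decode (g p x)))"
proof -
  have "dec_on A (\<lambda>p x. \<exists>k<length (list_decode (g p x)). entry (g p x) k = f p x)"
    by (intro rec_intros assms assms[THEN rec_comp])
  then show ?thesis by (simp add: entry_eq in_set_conv_nth cong: conj_cong)
qed

lemma dec_prefix [rec_intros]:
  assumes "rec_on A f" "rec_on A g"
  shows "dec_on A (\<lambda>p x. prefix (list_decode (f p x)) (list_decode (g p x)))"
proof -
  have "dec_on A (\<lambda>p x. length (list_decode (f p x)) \<le> length (list_decode (g p x)) \<and>
      (\<forall>k<length (list_decode (f p x)). entry (f p x) k = entry (g p x) k))"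
    by (intro rec_intros assms assms[THEN rec_comp])
  moreover have "length s \<le> length t \<and> (\<forall>k<length s. s ! k = t ! k) \<longleftrightarrow> prefix s t"
    for s t :: "nat list"
    by (metis nth_take_lemma prefix_def append_take_drop_id le_refl nth_append prefix_length_le take_all)
  ultimately show ?thesis by (simp add: entry_eq cong: conj_cong)
qed

lemma dec_binary [rec_intros]:
  assumes "rec_on A f"
  shows "dec_on A (\<lambda>p x. set (list_decode (f p x)) \<subseteq> {0, 1})"
proof -
  have "dec_on A (\<lambda>p x. \<forall>k<length (list_decode (f p x)). entry (f p x) k = 0 \<or> entry (f p x) k = 1)"
    by (intro rec_intros assms assms[THEN rec_comp])
  then show ?thesis by (simp add: entry_eq all_set_conv_all_nth subset_eq cong: imp_cong)
qed

section \<open>A universal evaluator in stages\<close>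

text \<open>
  One inference step of the big-step semantics. \<open>K c x v\<close> says that program number \<open>c\<close> is already
  known to yield \<open>v\<close> at \<open>x\<close>, and the disjuncts follow the constructors in the order of their
  codes. Intermediate results are only sought below \<open>b\<close>, which makes the predicate decidable; the
  evaluator lets \<open>b\<close> grow with the stage.
\<close>

definition justified ::
  "baire \<Rightarrow> (nat \<Rightarrow> nat \<Rightarrow> nat \<Rightarrow> bool) \<Rightarrow> nat \<Rightarrow> nat \<Rightarrow> nat \<Rightarrow> nat \<Rightarrow> bool" where
  "justified h K b c x v \<longleftrightarrow>
     c = 0 \<and> v = 0 \<or>
     c = 1 \<and> v = Suc x \<or>
     c = 2 \<and> v = pfst x \<or>
     c = 3 \<and> v = psnd x \<or>
     c = 4 \<and> v = h x \<or>
     (\<exists>k<c. c = 5 + 4 * k \<and> (\<exists>y<b. K (psnd k) x y \<and> K (pfst k) y v)) \<or>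
     (\<exists>k<c. c = 6 + 4 * k \<and> K (pfst k) x (pfst v) \<and> K (psnd k) x (psnd v)) \<or>
     (\<exists>k<c. c = 7 + 4 * k \<and>
        (if psnd x = 0 then K (pfst k) (pfst x) v
         else \<exists>w<b. K c (prod_encode (pfst x, psnd x - 1)) w \<and>
                K (psnd k) (prod_encode (pfst x, prod_encode (psnd x - 1, w))) v)) \<or>
     (\<exists>k<c. c = 8 + 4 * k \<and> K k (prod_encode (x, v)) 0 \<and>
        (\<forall>m<v. \<exists>w<b. K k (prod_encode (x, m)) (Suc w)))"

definition outcome :: "nat \<Rightarrow> nat \<Rightarrow> nat \<Rightarrow> nat" where
  "outcome c x v = prod_encode (c, prod_encode (x, v))"

text \<open>
  The code of the list of all outcomes derived before stage \<open>s\<close>. Stage \<open>s\<close> examines the single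
  outcome \<open>pfst s\<close>; as every number is \<open>pfst s\<close> for arbitrarily large \<open>s\<close>, each outcome is examined
  again after all its premises have been derived.
\<close>

primrec stage :: "baire \<Rightarrow> nat \<Rightarrow> nat" where
  "stage h 0 = 0"
| "stage h (Suc s) =
     (if justified h (\<lambda>c x v. outcome c x v \<in> set (list_decode (stage h s))) s
           (pfst (pfst s)) (pfst (psnd (pfst s))) (psnd (psnd (pfst s)))
      then Suc (prod_encode (pfst s, stage h s)) else stage h s)"

definition halts :: "baire \<Rightarrow> nat \<Rightarrow> nat \<Rightarrow> nat \<Rightarrow> nat \<Rightarrow> bool" where
  "halts h c x v s \<longleftrightarrow> outcome c x v \<in> set (list_decode (stage h s))"

lemma halts_0 [simp]: "\<not> halts h c x v 0"
  by (simp add: halts_def)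

lemma halts_Suc:
  "halts h c x v (Suc s) \<longleftrightarrow>
    halts h c x v s \<or> pfst s = outcome c x v \<and> justified h (\<lambda>c x v. halts h c x v s) s c x v"
proof (cases "pfst s = outcome c x v")
  case True
  then show ?thesis by (simp add: halts_def) (simp add: outcome_def)
next
  case False
  then show ?thesis by (auto simp: halts_def)
qed

lemma rec_stage [rec_intros]:
  assumes "rec_on A (\<lambda>r z. h r (pfst z) (psnd z))" "rec_on A s"
  shows "rec_on A (\<lambda>r x. stage (h r x) (s r x))"
proof -
  have h: "rec_on A (\<lambda>r x. h r (a r x) (b r x))" if "rec_on A a" "rec_on A b" for a b
    using rec_comp[OF assms(1) rec_prod_encode[OF that]] by simp
  have "rec_on A (\<lambda>r x. rec_nat 0
     (\<lambda>s d. if justified (h r x) (\<lambda>c x v. outcome c x v \<in> set (list_decode d)) s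
           (pfst (pfst s)) (pfst (psnd (pfst s))) (psnd (psnd (pfst s)))
      then Suc (prod_encode (pfst s, d)) else d) (s r x))"
    unfolding justified_def outcome_def by (intro rec_intros h assms(2))
  moreover have "stage g n = rec_nat 0
     (\<lambda>s d. if justified g (\<lambda>c x v. outcome c x v \<in> set (list_decode d)) s
           (pfst (pfst s)) (pfst (psnd (pfst s))) (psnd (psnd (pfst s)))
      then Suc (prod_encode (pfst s, d)) else d) n" for g n
    by (induction n) simp_all
  ultimately show ?thesis by simp
qed

lemma dec_halts [rec_intros]:
  assumes "rec_on A (\<lambda>r z. h r (pfst z) (psnd z))" "rec_on A c" "rec_on A x" "rec_on A v" "rec_on A s"
  shows "dec_on A (\<lambda>r z. halts (h r z) (c r z) (x r z) (v r z) (s r z))"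
  unfolding halts_def outcome_def by (intro rec_intros assms)

lemma halts_less: "halts h c x v s \<Longrightarrow> outcome c x v < s"
  by (induction s) (auto simp: halts_Suc intro: less_SucI, metis le_prod_encode_1 less_Suc_eq_le prod.collapse prod_decode_inverse)

lemma halts_components_less: assumes "halts h c x v s" shows "c < s" "x < s" "v < s"
proof -
  have "outcome c x v < s" using assms by (rule halts_less)
  moreover have "c \<le> outcome c x v" "prod_encode (x, v) \<le> outcome c x v"
    unfolding outcome_def by (rule le_prod_encode_1 le_prod_encode_2)+
  moreover have "x \<le> prod_encode (x, v)" "v \<le> prod_encode (x, v)"
    by (rule le_prod_encode_1 le_prod_encode_2)+
  ultimately show "c < s" "x < s" "v < s" by simp_all
qed

lemma halts_mono: "halts h c x v s \<Longrightarrow> s \<le> t \<Longrightarrow> halts h c x v t"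
  by (induction t) (auto simp: halts_Suc le_Suc_eq)

text \<open>
  The use of a computation is bounded by its stage: an outcome examined before stage \<open>s\<close> has a code
  below \<open>s\<close>, and so has the position at which it asks the oracle.
\<close>

lemma stage_cong: "(\<And>k. k < s \<Longrightarrow> h k = h' k) \<Longrightarrow> stage h s = stage h' s"
proof (induction s)
  case (Suc s)
  let ?x = "pfst (psnd (pfst s))"
  have "?x \<le> s"
    by (metis le_prod_encode_1 le_prod_encode_2 order.trans prod.collapse prod_decode_inverse)
  then have "h ?x = h' ?x" using Suc.prems by simp
  then have "justified h K b c ?x v = justified h' K b c ?x v" for K b c v
    by (simp add: justified_def)
  moreover have "stage h s = stage h' s" using Suc by simp
  ultimately show ?case by simp
qed simp

lemma halts_cong:
  "halts h c x v s \<Longrightarrow> (\<And>k. k < s \<Longrightarrow> h k = h' k) \<Longrightarrow> halts h' c x v s"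
  using stage_cong[of s h h'] by (simp add: halts_def)

lemma prog_decode_encode [simp]: "prog_decode (prog_encode c) = c"
  by (simp add: prog_decode_def inj_prog_encode)

lemma prog_encode_decode [simp]: "prog_encode (prog_decode n) = n"
  by (simp add: prog_decode_def surj_f_inv_f surj_prog_encode)

lemma prog_decode_simps:
  "prog_decode 0 = Zero" "prog_decode (Suc 0) = Succ" "prog_decode 2 = Fst" "prog_decode 3 = Snd"
  "prog_decode 4 = Oracle"
  "prog_decode (5 + 4 * k) = Comp (prog_decode (pfst k)) (prog_decode (psnd k))"
  "prog_decode (6 + 4 * k) = Pair (prog_decode (pfst k)) (prog_decode (psnd k))"
  "prog_decode (7 + 4 * k) = Prec (prog_decode (pfst k)) (prog_decode (psnd k))"
  "prog_decode (8 + 4 * k) = Mu (prog_decode k)"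
  by (rule injD[OF inj_prog_encode], simp)+

lemma eval_Prec_Suc:
  "eval h (Prec f g) (prod_encode (a, Suc m)) =
    Option.bind (eval h (Prec f g) (prod_encode (a, m)))
      (\<lambda>w. eval h g (prod_encode (a, prod_encode (m, w))))"
  by simp

lemma eval_MuI:
  assumes "eval h f (prod_encode (x, v)) = Some 0"
    and "\<And>m. m < v \<Longrightarrow> \<exists>w. eval h f (prod_encode (x, m)) = Some (Suc w)"
  shows "eval h (Mu f) x = Some v"
proof -
  have "(LEAST n. eval h f (prod_encode (x, n)) = Some 0) = v"
  proof (rule Least_equality)
    show "v \<le> y" if "eval h f (prod_encode (x, y)) = Some 0" for y
      using that assms(2)[of y] by (cases "y < v") auto
  qed (rule assms)
  moreover have "\<forall>m<v. eval h f (prod_encode (x, m)) \<noteq> None" using assms(2) by force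
  ultimately show ?thesis using assms(1) by auto
qed

lemma eval_MuD:
  assumes "eval h (Mu f) x = Some v"
  shows "eval h f (prod_encode (x, v)) = Some 0"
    and "m < v \<Longrightarrow> \<exists>w. eval h f (prod_encode (x, m)) = Some (Suc w)"
proof -
  let ?P = "\<lambda>n. eval h f (prod_encode (x, n)) = Some 0"
  obtain n where n: "?P n" "\<forall>m<n. eval h f (prod_encode (x, m)) \<noteq> None" and v: "v = (LEAST n. ?P n)"
    using assms by (auto split: if_splits)
  show "?P v" unfolding v using n(1) by (rule LeastI)
  assume "m < v"
  moreover have "v \<le> n" unfolding v using n(1) by (rule Least_le)
  moreover have "\<not> ?P m" using \<open>m < v\<close> unfolding v by (rule not_less_Least)
  ultimately show "\<exists>w. eval h f (prod_encode (x, m)) = Some (Suc w)"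
    using n(2) by (metis less_le_trans not0_implies_Suc option.exhaust)
qed

lemma justified_sound:
  assumes "justified h K b c x v"
    and K: "\<And>c x v. K c x v \<Longrightarrow> eval h (prog_decode c) x = Some v"
  shows "eval h (prog_decode c) x = Some v"
  using assms(1) unfolding justified_def
proof (elim disjE exE conjE)
  fix k assume c: "c = 7 + 4 * k" and K': "if psnd x = 0 then K (pfst k) (pfst x) v
         else \<exists>w<b. K c (prod_encode (pfst x, psnd x - 1)) w \<and>
                K (psnd k) (prod_encode (pfst x, prod_encode (psnd x - 1, w))) v"
  have x: "x = prod_encode (pfst x, psnd x)" by simp
  show ?thesis
  proof (cases "psnd x")
    case 0
    then show ?thesis using K K' by (simp add: c prog_decode_simps case_prod_beta)
  next
    case (Suc m)
    then obtain w where w: "K c (prod_encode (pfst x, m)) w"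
      "K (psnd k) (prod_encode (pfst x, prod_encode (m, w))) v" using K' by auto
    have "x = prod_encode (pfst x, Suc m)" using x Suc by simp
    then show ?thesis
      using K[OF w(1)] K[OF w(2)]
      by (metis c prog_decode_simps(8) eval_Prec_Suc bind.bind_lunit)
  qed
next
  fix k assume c: "c = 8 + 4 * k" and "K k (prod_encode (x, v)) 0"
    "\<forall>m<v. \<exists>w<b. K k (prod_encode (x, m)) (Suc w)"
  then show ?thesis
    unfolding c prog_decode_simps by (intro eval_MuI) (auto dest: K)
qed (auto simp: prog_decode_simps dest!: K)

lemma halts_sound: "halts h c x v s \<Longrightarrow> eval h (prog_decode c) x = Some v"
proof (induction s arbitrary: c x v)
  case (Suc s)
  show ?case
  proof (cases "halts h c x v s")
    case False
    then have "justified h (\<lambda>c x v. halts h c x v s) s c x v"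
      using Suc.prems by (simp add: halts_Suc)
    then show ?thesis using Suc.IH by (rule justified_sound)
  qed (rule Suc.IH)
qed simp

text \<open>
  A step that is justified at stage \<open>s\<close> stays justified later on, so it is taken at the stage
  \<open>prod_encode (outcome c x v, s)\<close>, which is at least \<open>s\<close> and examines this outcome.
\<close>

lemma halts_if_justified:
  assumes "justified h (\<lambda>c x v. halts h c x v s) s c x v"
  shows "\<exists>s. halts h c x v s"
proof -
  have mono: "justified h (\<lambda>c x v. halts h c x v t) t c x v" if "s \<le> t" for t
  proof -
    have K: "halts h c x v s \<longrightarrow> halts h c x v t" for c x v using halts_mono that by blast
    have b: "m < s \<Longrightarrow> m < t" for m using that by simp
    show ?thesis using assms unfolding justified_def
      by (smt (verit) K b)
  qed
  define t where "t = prod_encode (outcome c x v, s)"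
  have "s \<le> t" unfolding t_def by (rule le_prod_encode_2)
  then have "halts h c x v (Suc t)" using mono by (simp add: halts_Suc t_def)
  then show ?thesis ..
qed


text \<open>
  By induction on the program. The finitely many premises of a step, which for \<^const>\<open>Mu\<close> are the
  values at all smaller arguments, have been derived at a common stage, which also exceeds all the
  intermediate values.
\<close>

lemma halts_complete:
  "eval h c x = Some v \<Longrightarrow> \<exists>s. halts h (prog_encode c) x v s"
proof (induction c arbitrary: x v)
  case (Comp f g)
  then obtain y where "eval h g x = Some y" "eval h f y = Some v"
    by (auto simp: bind_eq_Some_conv)
  with Comp.IH obtain s1 s2 where "halts h (prog_encode g) x y s1" "halts h (prog_encode f) y v s2"
    by blast
  then have *: "halts h (prog_encode g) x y (max s1 s2)" "halts h (prog_encode f) y v (max s1 s2)"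
    by (auto intro: halts_mono)
  show ?case
    by (rule halts_if_justified[of _ "max s1 s2"])
      (use * halts_components_less(3)[OF *(1)] in \<open>auto simp: justified_def\<close>)
next
  case (Pair f g)
  then obtain y z where v: "eval h f x = Some y" "eval h g x = Some z" "v = prod_encode (y, z)"
    by (auto simp: bind_eq_Some_conv)
  with Pair.IH obtain s1 s2 where "halts h (prog_encode f) x y s1" "halts h (prog_encode g) x z s2"
    by blast
  then have *: "halts h (prog_encode f) x y (max s1 s2)" "halts h (prog_encode g) x z (max s1 s2)"
    by (auto intro: halts_mono)
  show ?case
    by (rule halts_if_justified[of _ "max s1 s2"]) (use * v in \<open>auto simp: justified_def\<close>)
next
  case (Prec f g)
  have "\<exists>s. halts h (prog_encode (Prec f g)) (prod_encode (a, n)) v s"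
    if "eval h (Prec f g) (prod_encode (a, n)) = Some v" for a n v
    using that
  proof (induction n arbitrary: v)
    case 0
    then obtain s where "halts h (prog_encode f) a v s" using Prec.IH(1)[of a v] by auto
    then show ?case
      by (intro halts_if_justified[of _ s]) (auto simp: justified_def)
  next
    case (Suc n)
    then obtain w where "eval h (Prec f g) (prod_encode (a, n)) = Some w"
      and "eval h g (prod_encode (a, prod_encode (n, w))) = Some v"
      unfolding eval_Prec_Suc bind_eq_Some_conv by blast
    with Suc.IH Prec.IH(2) obtain s1 s2 where
      "halts h (prog_encode (Prec f g)) (prod_encode (a, n)) w s1"
      "halts h (prog_encode g) (prod_encode (a, prod_encode (n, w))) v s2" by blast
    then have *: "halts h (prog_encode (Prec f g)) (prod_encode (a, n)) w (max s1 s2)"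
      "halts h (prog_encode g) (prod_encode (a, prod_encode (n, w))) v (max s1 s2)"
      by (auto intro: halts_mono)
    show ?case
      by (rule halts_if_justified[of _ "max s1 s2"])
        (use * halts_components_less(3)[OF *(1)] in \<open>auto simp: justified_def\<close>)
  qed
  from this[of "pfst x" "psnd x" v] show ?case using Prec.prems by simp
next
  case (Mu f)
  obtain s0 where s0: "halts h (prog_encode f) (prod_encode (x, v)) 0 s0"
    using Mu.IH[OF eval_MuD(1)[OF Mu.prems]] by blast
  have "\<exists>w s. halts h (prog_encode f) (prod_encode (x, m)) (Suc w) s" if "m < v" for m
    using Mu.IH eval_MuD(2)[OF Mu.prems that] by blast
  then obtain W S where W: "\<And>m. m < v \<Longrightarrow> halts h (prog_encode f) (prod_encode (x, m)) (Suc (W m)) (S m)"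
    by metis
  define s where "s = s0 + (\<Sum>m<v. S m)"
  have "S m \<le> s" if "m < v" for m
    using member_le_sum[of m "{..<v}" S] that by (simp add: s_def)
  then have m: "halts h (prog_encode f) (prod_encode (x, m)) (Suc (W m)) s" if "m < v" for m
    using W halts_mono that by blast
  have "\<exists>w<s. halts h (prog_encode f) (prod_encode (x, m)) (Suc w) s" if "m < v" for m
    using m[OF that] halts_components_less(3)[OF m[OF that]] by (intro exI[of _ "W m"]) auto
  moreover have "halts h (prog_encode f) (prod_encode (x, v)) 0 s"
    using s0 by (rule halts_mono) (simp add: s_def)
  ultimately show ?case
    by (intro halts_if_justified[of _ s]) (auto simp: justified_def)
qed (auto intro!: halts_if_justified[where s = 0] simp: justified_def)

lemma halts_iff_eval: "(\<exists>s. halts h c x v s) \<longleftrightarrow> eval h (prog_decode c) x = Some v"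
  using halts_sound halts_complete[of h "prog_decode c"] by auto

section \<open>Infinite binary trees\<close>

text \<open>
  Follow the nodes that have infinitely many extensions in the tree: one of the two successors of
  such a node has this property again.
\<close>

lemma weak_koenig:
  assumes T: "binary_tree T" and "infinite T"
  shows "\<exists>q. infinite_path T q"
proof -
  define big where "big s \<longleftrightarrow> infinite {t \<in> T. prefix s t}" for s
  have step: "\<exists>b. big (s @ [b])" if "big s" for s
  proof (rule ccontr)
    assume "\<nexists>b. big (s @ [b])"
    then have "finite (insert s ({t \<in> T. prefix (s @ [0]) t} \<union> {t \<in> T. prefix (s @ [1]) t}))"
      unfolding big_def by blast
    moreover have "{t \<in> T. prefix s t} \<subseteq> insert s ({t \<in> T. prefix (s @ [0]) t} \<union> {t \<in> T. prefix (s @ [1]) t})"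
    proof
      fix t assume "t \<in> {t \<in> T. prefix s t}"
      then have t: "t \<in> T" "prefix s t" by auto
      show "t \<in> insert s ({t \<in> T. prefix (s @ [0]) t} \<union> {t \<in> T. prefix (s @ [1]) t})"
      proof (cases "t = s")
        case False
        with t(2) obtain b u where tbu: "t = s @ b # u" by (metis append_Nil2 list.exhaust prefixE)
        moreover have "b = 0 \<or> b = 1" using t(1) T tbu unfolding binary_tree_def by force
        ultimately show ?thesis using t(1) by auto
      qed simp
    qed
    ultimately show False using that finite_subset unfolding big_def by blast
  qed
  define f where "f = rec_nat [] (\<lambda>_ s. s @ [SOME b. big (s @ [b])])"
  define q where "q n = (SOME b. big (f n @ [b]))" for n
  have f: "f 0 = []" "f (Suc n) = f n @ [q n]" for n by (simp_all add: f_def q_def)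
  have "big (f n)" for n
  proof (induction n)
    case 0
    show ?case using \<open>infinite T\<close> by (simp add: f big_def)
  next
    case (Suc n)
    from step[OF this] show ?case unfolding f q_def by (rule someI_ex)
  qed
  moreover have "f n = map q [0..<n]" for n by (induction n) (simp_all add: f)
  ultimately have "big (map q [0..<n])" for n by metis
  moreover have "s \<in> T" if "big s" for s
  proof -
    have "{t \<in> T. prefix s t} \<noteq> {}" using that unfolding big_def by (metis finite.emptyI)
    then show ?thesis using T unfolding binary_tree_def by blast
  qed
  ultimately show ?thesis unfolding infinite_path_def by blast
qed

lemma inj_char_fun: "char_fun S = char_fun T \<longleftrightarrow> S = T"
proof
  assume "char_fun S = char_fun T"
  then have "(s \<in> S) = (s \<in> T)" for s
    by (auto simp: char_fun_def fun_eq_iff split: if_splits dest!: spec[of _ "list_encode s"])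
  then show "S = T" by blast
qed simp

lemma C_Cantor_char_fun:
  "binary_tree T \<Longrightarrow> infinite T \<Longrightarrow> C_Cantor (char_fun T) = {q. infinite_path T q}"
  unfolding C_Cantor_def inj_char_fun by auto

lemma char_fun_mem_pdom: "binary_tree T \<Longrightarrow> infinite T \<Longrightarrow> char_fun T \<in> pdom C_Cantor"
  using weak_koenig by (auto simp: pdom_def C_Cantor_char_fun)

lemma pdom_C_CantorE:
  assumes "x \<in> pdom C_Cantor"
  obtains T where "binary_tree T" "infinite T" "x = char_fun T"
  using assms by (auto simp: pdom_def C_Cantor_def)

lemma Phi_Some_iff: "Phi e p = Some y \<longleftrightarrow> (\<forall>n. eval p (prog_decode e) n = Some (y n))"
proof
  assume y: "Phi e p = Some y"
  show "\<forall>n. eval p (prog_decode e) n = Some (y n)"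
  proof
    fix n
    have "eval p (prog_decode e) n \<noteq> None" using y by (auto simp: Phi_def split: if_splits)
    then show "eval p (prog_decode e) n = Some (y n)"
      using y by (auto simp: Phi_def split: if_splits)
  qed
qed (simp add: Phi_def)

section \<open>Observing the hypotheses of the tot-jump\<close>

definition pad :: "nat list \<Rightarrow> baire" where
  "pad s k = (if k < length s then s ! k else 0)"

text \<open>
  A total substitute for the tree with characteristic function \<open>Phi e p\<close>: a node is discarded only
  if, within as many stages as it is long, some prefix of it is seen to lie outside that tree.
  Whatever \<open>e\<close> and \<open>p\<close> are, this is a binary tree with decidable membership. If \<open>Phi e p\<close> describes
  a binary tree, then the substitute may add finite branches to it, but no paths. The bound on \<open>a\<close>
  loses nothing, because an outcome that is derived within \<open>n\<close> stages has input below \<open>n\<close>.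
\<close>

definition approx_tree :: "nat \<Rightarrow> baire \<Rightarrow> nat list set" where
  "approx_tree e p = {s. set s \<subseteq> {0, 1} \<and>
     (\<forall>a<length s. prefix (list_decode a) s \<longrightarrow> \<not> halts p e a 0 (length s))}"

lemma binary_tree_approx_tree: "binary_tree (approx_tree e p)"
  unfolding binary_tree_def
proof (intro conjI ballI allI impI)
  fix s t assume s: "s \<in> approx_tree e p" and t: "prefix t s"
  have len: "length t \<le> length s" using t by (rule prefix_length_le)
  have "\<not> halts p e a 0 (length t)" if "a < length t" "prefix (list_decode a) t" for a
    using that s t len halts_mono[OF _ len] unfolding approx_tree_def
    by (auto dest: prefix_order.trans order.strict_trans2)
  then show "t \<in> approx_tree e p"
    using s set_mono_prefix[OF t] by (auto simp: approx_tree_def)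
qed (auto simp: approx_tree_def)

lemma subset_approx_tree:
  assumes "Phi e p = Some (char_fun T)" "binary_tree T"
  shows "T \<subseteq> approx_tree e p"
proof
  fix s assume s: "s \<in> T"
  have "\<not> halts p e a 0 n" if "prefix (list_decode a) s" for a n
  proof
    assume "halts p e a 0 n"
    then have "char_fun T a = 0"
      using assms(1) halts_sound[of p e a 0 n] by (simp add: Phi_Some_iff)
    moreover have "list_decode a \<in> T" using that s assms(2) by (auto simp: binary_tree_def)
    ultimately show False by (simp add: char_fun_def)
  qed
  then show "s \<in> approx_tree e p"
    using s assms(2) by (auto simp: approx_tree_def binary_tree_def)
qed

lemma prefix_map_upt: "m \<le> n \<Longrightarrow> prefix (map q [0..<m]) (map q [0..<n])"
  by (metis le_add_diff_inverse map_append prefixI upt_add_eq_append zero_le)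

text \<open>
  If a path leaves the tree at some prefix, then this is observed at some stage, and all longer
  prefixes of the path are discarded from that stage on.
\<close>

lemma infinite_path_approx_tree:
  assumes "Phi e p = Some (char_fun T)" "infinite_path (approx_tree e p) q"
  shows "infinite_path T q"
  unfolding infinite_path_def
proof (intro allI, rule ccontr)
  fix m assume "map q [0..<m] \<notin> T"
  define a where "a = list_encode (map q [0..<m])"
  have "char_fun T a = 0" using \<open>_ \<notin> T\<close> by (simp add: char_fun_def a_def)
  then have "eval p (prog_decode e) a = Some 0" using assms(1) by (auto simp: Phi_Some_iff)
  then obtain s where s: "halts p e a 0 s" using halts_iff_eval by blast
  define n where "n = max s m"
  have "halts p e a 0 n" using s by (rule halts_mono) (simp add: n_def)
  moreover have "prefix (list_decode a) (map q [0..<n])"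
    using prefix_map_upt[of m n q] by (simp add: a_def n_def)
  moreover have "map q [0..<n] \<in> approx_tree e p" using assms(2) by (simp add: infinite_path_def)
  ultimately show False using halts_components_less(2)[of p e a 0 n] by (auto simp: approx_tree_def)
qed

text \<open>
  At level \<open>L\<close> every node already contains enough information to determine the \<open>n\<close>-th value of
  the functional with number \<open>i\<close> within \<open>L\<close> stages. The oracle continues the node by zeros, but
  those are not read, as only positions below \<open>L\<close> are.
\<close>

definition covered :: "nat \<Rightarrow> nat \<Rightarrow> baire \<Rightarrow> nat \<Rightarrow> nat \<Rightarrow> bool" where
  "covered e i p n L \<longleftrightarrow>
     (\<forall>s\<in>approx_tree e p. length s = L \<longrightarrow> (\<exists>v<L. halts (bpair p (pad s)) i n v L))"

lemma halts_bpair_cong: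
  assumes "halts (bpair p q) i n v L" "\<And>k. k < L \<Longrightarrow> q k = q' k"
  shows "halts (bpair p q') i n v L"
  using assms(1) by (rule halts_cong) (auto simp: bpair_def intro!: assms(2))

lemma covered_mono:
  assumes "covered e i p n L" "L \<le> L'"
  shows "covered e i p n L'"
  unfolding covered_def
proof (intro ballI impI)
  fix s assume s: "s \<in> approx_tree e p" "length s = L'"
  have "take L s \<in> approx_tree e p"
    using s(1) binary_tree_approx_tree take_is_prefix unfolding binary_tree_def by blast
  then obtain v where v: "v < L" "halts (bpair p (pad (take L s))) i n v L"
    using assms s(2) unfolding covered_def by (metis length_take min.absorb2)
  from v(2) have "halts (bpair p (pad s)) i n v L"
    by (rule halts_bpair_cong) (use assms(2) s(2) in \<open>auto simp: pad_def\<close>)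
  then show "\<exists>v<L'. halts (bpair p (pad s)) i n v L'"
    using v(1) assms(2) by (meson halts_mono less_le_trans)
qed

lemma covered_path:
  assumes "covered e i p n L" "infinite_path (approx_tree e p) q"
  shows "\<exists>v<L. halts (bpair p q) i n v L"
proof -
  have "map q [0..<L] \<in> approx_tree e p" using assms(2) by (simp add: infinite_path_def)
  then obtain v where "v < L" "halts (bpair p (pad (map q [0..<L]))) i n v L"
    using assms(1) unfolding covered_def by force
  from this(2) have "halts (bpair p q) i n v L"
    by (rule halts_bpair_cong) (simp add: pad_def)
  with \<open>v < L\<close> show ?thesis by blast
qed

text \<open>
  Compactness: the nodes at which the \<open>n\<close>-th value is still unknown form a binary tree. If no level
  is covered, this tree is infinite and has a path \<open>q\<close>, along which the value is never computed.
\<close>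

lemma ex_covered:
  assumes "\<And>q. infinite_path (approx_tree e p) q \<Longrightarrow> eval (bpair p q) (prog_decode i) n \<noteq> None"
  shows "\<exists>L. covered e i p n L"
proof (rule ccontr)
  assume nc: "\<nexists>L. covered e i p n L"
  define S where "S = {s \<in> approx_tree e p. \<forall>v. \<not> halts (bpair p (pad s)) i n v (length s)}"
  have "binary_tree S"
    unfolding binary_tree_def
  proof (intro conjI ballI allI impI)
    fix s t assume s: "s \<in> S" and t: "prefix t s"
    have len: "length t \<le> length s" using t by (rule prefix_length_le)
    have "t \<in> approx_tree e p"
      using s t binary_tree_approx_tree unfolding binary_tree_def S_def by blast
    moreover have "\<not> halts (bpair p (pad t)) i n v (length t)" for v
    proof
      assume "halts (bpair p (pad t)) i n v (length t)"
      then have "halts (bpair p (pad s)) i n v (length t)"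
        by (rule halts_bpair_cong) (use t in \<open>auto simp: pad_def prefix_def nth_append\<close>)
      then show False using s halts_mono[OF _ len, of "bpair p (pad s)" i n v] by (auto simp: S_def)
    qed
    ultimately show "t \<in> S" by (simp add: S_def)
  qed (auto simp: S_def approx_tree_def)
  moreover have "infinite S"
  proof
    assume "finite S"
    moreover have "L \<in> length ` S" for L
    proof -
      have "\<not> covered e i p n L" using nc by blast
      then obtain s where s: "s \<in> approx_tree e p" "length s = L"
        and *: "\<And>v. v < L \<Longrightarrow> \<not> halts (bpair p (pad s)) i n v L"
        unfolding covered_def by blast
      have "\<not> halts (bpair p (pad s)) i n v L" for v
        using * halts_components_less(3)[of "bpair p (pad s)" i n v L] by blast
      then have "s \<in> S" using s by (simp add: S_def)
      then show ?thesis using s(2) by blast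
    qed
    ultimately show False by (metis finite_imageI finite_subset infinite_UNIV_nat subsetI)
  qed
  ultimately obtain q where q: "infinite_path S q" using weak_koenig by blast
  then have "infinite_path (approx_tree e p) q" by (simp add: infinite_path_def S_def)
  then obtain v where "eval (bpair p q) (prog_decode i) n = Some v" using assms by blast
  then obtain L where "halts (bpair p q) i n v L" using halts_iff_eval by blast
  then have "halts (bpair p (pad (map q [0..<L]))) i n v L"
    by (rule halts_bpair_cong) (simp add: pad_def)
  moreover have "map q [0..<L] \<in> S" using q by (simp add: infinite_path_def)
  ultimately show False by (simp add: S_def)
qed

text \<open>
  \<open>level e i p s\<close> counts how many of the requirements \<open>covered e i p 0\<close>, \<open>covered e i p 1\<close>,
  \<dots> have been met, in this order and at most one at each stage, before stage \<open>s\<close>. The signal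
  is zero exactly at the stages that meet another one, so that it has infinitely many zeros iff
  all requirements are eventually met.
\<close>

primrec level :: "nat \<Rightarrow> nat \<Rightarrow> baire \<Rightarrow> nat \<Rightarrow> nat" where
  "level e i p 0 = 0"
| "level e i p (Suc s) =
     (if covered e i p (level e i p s) s then Suc (level e i p s) else level e i p s)"

definition signal :: "nat \<Rightarrow> nat \<Rightarrow> baire \<Rightarrow> baire" where
  "signal e i p s = (if covered e i p (level e i p s) s then 0 else 1)"

lemma level_mono: "s \<le> t \<Longrightarrow> level e i p s \<le> level e i p t"
  by (rule lift_Suc_mono_le[of "level e i p"]) auto

lemma covered_below_level: "n < level e i p s \<Longrightarrow> covered e i p n s"
  by (induction s) (auto simp: less_Suc_eq split: if_splits intro: covered_mono)

text \<open>
  By the \<open>n\<close>-th zero at the latest, the first \<open>n\<close> requirements have been met at earlier zeros, so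
  requirement number \<open>n\<close> is met at this zero unless it was met before; and once met, a requirement
  stays met at all greater levels.
\<close>

lemma W_problem_signal:
  assumes "w \<in> W_problem (signal e i p)"
  shows "covered e i p n (w n)"
proof -
  have c: "covered e i p (level e i p (w n)) (w n)" for n
    using assms by (auto simp: W_problem_def signal_def fun_eq_iff split: if_splits)
  have less: "Suc (w n) \<le> w (Suc n)" for n using assms by (simp add: W_problem_def Suc_le_eq)
  have "n \<le> level e i p (w n)" for n
  proof (induction n)
    case (Suc n)
    have "Suc n \<le> level e i p (Suc (w n))" using Suc c[of n] by simp
    also have "\<dots> \<le> level e i p (w (Suc n))" using less by (rule level_mono)
    finally show ?case .
  qed simp
  from this[of n] show ?thesis using c[of n] covered_below_level[of n e i p "w n"]
    by (cases "n = level e i p (w n)") auto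
qed

lemma W_problem_nonempty:
  assumes "infinite {s. z s = 0}"
  shows "z \<in> pdom W_problem"
proof -
  have "enumerate {s. z s = 0} \<in> W_problem z"
    using enumerate_in_set[OF assms] enumerate_step[OF assms] by (auto simp: W_problem_def)
  then show ?thesis by (auto simp: pdom_def)
qed

text \<open>
  Without zeros after stage \<open>m\<close>, the level would be constant from \<open>m\<close> on, although the
  requirement it points to is met at all sufficiently late stages.
\<close>

lemma infinite_signal:
  assumes "\<And>n. \<exists>L. covered e i p n L"
  shows "infinite {s. signal e i p s = 0}"
  unfolding infinite_nat_iff_unbounded_le
proof
  fix m
  show "\<exists>s\<ge>m. s \<in> {s. signal e i p s = 0}"
  proof (rule ccontr)
    assume no: "\<not> (\<exists>s\<ge>m. s \<in> {s. signal e i p s = 0})"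
    then have nc: "\<not> covered e i p (level e i p s) s" if "m \<le> s" for s
      using that by (auto simp: signal_def)
    have const: "level e i p (m + d) = level e i p m" for d
    proof (induction d)
      case (Suc d)
      then show ?case using nc[of "m + d"] by simp
    qed simp
    obtain L where "covered e i p (level e i p m) L" using assms by blast
    then have "covered e i p (level e i p (m + L)) (m + L)"
      unfolding const by (rule covered_mono) simp
    then show False using nc by simp
  qed
qed

subsection \<open>Computability of the tree and of the signal\<close>

lemma prod_encode_mono: "a \<le> a' \<Longrightarrow> b \<le> b' \<Longrightarrow> prod_encode (a, b) \<le> prod_encode (a', b')"
proof -
  assume *: "a \<le> a'" "b \<le> b'"
  have "mono triangle" by (rule mono_iff_le_Suc[THEN iffD2]) simp
  then show ?thesis using * monoD[of triangle "a + b" "a' + b'"] by (simp add: prod_encode_def)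
qed

text \<open>
  This bound turns the quantifier over the binary lists of a given length into a bounded numerical
  quantifier.
\<close>

lemma list_encode_binary_le:
  "set s \<subseteq> {0, 1} \<Longrightarrow> list_encode s \<le> list_encode (replicate (length s) 1)"
  by (induction s) (auto intro!: prod_encode_mono)

lemma rec_list_encode_replicate [rec_intros]:
  assumes "rec_on A f"
  shows "rec_on A (\<lambda>p x. list_encode (replicate (f p x) 1))"
proof -
  have "rec_on A (\<lambda>p x. rec_nat 0 (\<lambda>_ v. Suc (prod_encode (1, v))) (f p x))"
    by (intro rec_intros assms)
  moreover have "rec_nat 0 (\<lambda>_ v. Suc (prod_encode (1, v))) n = list_encode (replicate n 1)" for n
    by (induction n) simp_all
  ultimately show ?thesis by (simp only:)
qed

lemma dec_approx_tree [rec_intros]: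
  assumes e: "rec_on A e" and p: "rec_on A (\<lambda>r z. p r (pfst z) (psnd z))" and u: "rec_on A u"
  shows "dec_on A (\<lambda>r x. list_decode (u r x) \<in> approx_tree (e r x) (p r x))"
proof -
  have p': "rec_on A (\<lambda>r x. p r (a r x) (b r x))" if "rec_on A a" "rec_on A b" for a b
    using rec_comp[OF p rec_prod_encode[OF that]] by simp
  show ?thesis
    unfolding approx_tree_def mem_Collect_eq
    by (intro rec_intros p' rec_comp[OF e] rec_comp[OF u])
qed

lemma entry_pad: "entry u = pad (list_decode u)"
  by (rule ext) (simp add: entry_eq pad_def)

lemma covered_iff:
  "covered e i p n L \<longleftrightarrow> (\<forall>u<Suc (list_encode (replicate L 1)).
     list_decode u \<in> approx_tree e p \<longrightarrow> length (list_decode u) = L \<longrightarrow>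
       (\<exists>v<L. halts (bpair p (entry u)) i n v L))"
  (is "?l \<longleftrightarrow> ?r")
proof
  assume ?l
  then show ?r by (simp add: covered_def entry_pad)
next
  assume r: ?r
  show ?l unfolding covered_def
  proof (intro ballI impI)
    fix s assume s: "s \<in> approx_tree e p" "length s = L"
    then have "list_encode s < Suc (list_encode (replicate L 1))"
      using list_encode_binary_le[of s] by (auto simp: approx_tree_def less_Suc_eq_le)
    then show "\<exists>v<L. halts (bpair p (pad s)) i n v L"
      using r s by (metis entry_pad list_encode_inverse)
  qed
qed

lemma dec_covered [rec_intros]:
  assumes e: "rec_on A e" and i: "rec_on A i" and p: "rec_on A (\<lambda>r z. p r (pfst z) (psnd z))"
    and n: "rec_on A n" and L: "rec_on A L"
  shows "dec_on A (\<lambda>r x. covered (e r x) (i r x) (p r x) (n r x) (L r x))"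
proof -
  have p': "rec_on A (\<lambda>r x. p r (a r x) (b r x))" if "rec_on A a" "rec_on A b" for a b
    using rec_comp[OF p rec_prod_encode[OF that]] by simp
  show ?thesis
    unfolding covered_iff bpair_def
    by (intro rec_intros p' rec_comp[OF e] rec_comp[OF i] rec_comp[OF n] rec_comp[OF L])
qed

lemma rec_level [rec_intros]:
  assumes e: "rec_on A e" and i: "rec_on A i" and p: "rec_on A (\<lambda>r z. p r (pfst z) (psnd z))"
    and s: "rec_on A s"
  shows "rec_on A (\<lambda>r x. level (e r x) (i r x) (p r x) (s r x))"
proof -
  have p': "rec_on A (\<lambda>r x. p r (a r x) (b r x))" if "rec_on A a" "rec_on A b" for a b
    using rec_comp[OF p rec_prod_encode[OF that]] by simp
  have "rec_on A (\<lambda>r x. rec_nat 0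
      (\<lambda>t k. if covered (e r x) (i r x) (p r x) k t then Suc k else k) (s r x))"
    by (intro rec_intros p' rec_comp[OF e] rec_comp[OF i] s)
  moreover have "level e i p s = rec_nat 0 (\<lambda>t k. if covered e i p k t then Suc k else k) s"
    for e i p s by (induction s) simp_all
  ultimately show ?thesis by simp
qed

section \<open>The two reductions\<close>

lemma computable_if_rec_on:
  assumes "rec_on A f"
  shows "\<exists>e. \<forall>p\<in>A. Phi e p = Some (f p)"
proof -
  obtain c where "\<forall>p\<in>A. \<forall>x. eval p c x = Some (f p x)" using assms unfolding rec_on_def by blast
  then show ?thesis by (intro exI[of _ "prog_encode c"]) (simp add: Phi_Some_iff)
qed

lemma pdom_totalization [simp]: "pdom (totalization f) = UNIV"
  by (auto simp: pdom_def totalization_def)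

text \<open>
  The backward functional \<open>G\<close> reads the \<open>n\<close>-th value of \<open>Phi i (p, q)\<close> off from stage \<open>w n\<close> of the
  evaluation, where \<open>(q, w)\<close> is the solution it is given. It is total because it stops at the
  default value \<open>w n\<close> if that stage shows no result. This settles all instances at which the
  tot-jump is unrestricted, even though \<open>q\<close> and \<open>w\<close> may then be arbitrary. At the other instances
  \<open>w n\<close> is a stage at which the \<open>n\<close>-th value is known on all paths of the tree, in particular on \<open>q\<close>.
\<close>

lemma tot_jump_C_Cantor_le: "tot_jump C_Cantor \<le>\<^sub>W totalization (C_Cantor \<times>\<^sub>W W_problem)"
proof -
  define t where "t r = char_fun (approx_tree (r 0) (\<lambda>n. r (n + 2)))" for r :: baire
  define z where "z r = signal (r 0) (r 1) (\<lambda>n. r (n + 2))" for r :: baire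
  define G where "G X n = (LEAST v. v = bsnd (bsnd X) n \<or>
    halts (bpair (\<lambda>n. bfst X (n + 2)) (bfst (bsnd X))) (bfst X 1) n v (bsnd (bsnd X) n))"
    for X :: baire and n
  have "rec_on UNIV (\<lambda>r. bpair (t r) (z r))"
    unfolding bpair_def t_def z_def char_fun_def signal_def by (intro rec_intros)
  then obtain F' where F': "\<And>r. Phi F' r = Some (bpair (t r) (z r))"
    using computable_if_rec_on by blast
  \<comment> \<open>the only search succeeds for every oracle, as it stops at its default value\<close>
  have "rec_on UNIV G"
    unfolding G_def bpair_def bfst_def bsnd_def by (intro rec_intros) auto
  then obtain G' where G': "\<And>X. Phi G' X = Some (G X)"
    using computable_if_rec_on by blast
  have "\<exists>y\<in>tot_jump C_Cantor r. G (bpair r Q) = y"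
    if Q: "Q \<in> totalization (C_Cantor \<times>\<^sub>W W_problem) (bpair (t r) (z r))" for r Q
  proof (cases "tot_jump C_Cantor r = UNIV")
    case False
    define e i p where "e = r 0" and "i = r 1" and "p = (\<lambda>n. r (n + 2))"
    from False obtain x where x: "Phi e p = Some x" "x \<in> pdom C_Cantor"
      and i: "\<And>q. q \<in> C_Cantor x \<Longrightarrow> Phi i (bpair p q) \<noteq> None"
      and J: "tot_jump C_Cantor r = {y. \<exists>q\<in>C_Cantor x. Phi i (bpair p q) = Some y}"
      by (auto simp: tot_jump_def e_def i_def p_def Let_def split: option.splits if_splits)
    from x(2) obtain T where T: "binary_tree T" "infinite T" "x = char_fun T"
      by (rule pdom_C_CantorE)
    have x': "Phi e p = Some (char_fun T)" using x(1) T(3) by simp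
    have path: "q \<in> C_Cantor x" if "infinite_path (approx_tree e p) q" for q
      using infinite_path_approx_tree[OF x' that] T by (simp add: C_Cantor_char_fun)
    have inf: "infinite (approx_tree e p)"
      using subset_approx_tree[OF x' T(1)] T(2) infinite_super by blast
    have "\<exists>L. covered e i p n L" for n
    proof (rule ex_covered)
      fix q assume "infinite_path (approx_tree e p) q"
      then have "Phi i (bpair p q) \<noteq> None" using i path by blast
      then show "eval (bpair p q) (prog_decode i) n \<noteq> None" by (auto simp: Phi_Some_iff)
    qed
    then have "infinite {s. signal e i p s = 0}" by (rule infinite_signal)
    then have "signal e i p \<in> pdom W_problem" by (rule W_problem_nonempty)
    moreover have "char_fun (approx_tree e p) \<in> pdom C_Cantor"
      using binary_tree_approx_tree inf by (rule char_fun_mem_pdom)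
    ultimately have "Q \<in> (C_Cantor \<times>\<^sub>W W_problem) (bpair (t r) (z r))"
      using Q by (simp add: totalization_def bpair_mem_pdom_parallel t_def z_def e_def i_def p_def)
    then obtain q w where Qqw: "Q = bpair q w" and "q \<in> C_Cantor (char_fun (approx_tree e p))"
      and w: "w \<in> W_problem (signal e i p)"
      by (auto simp: parallel_def t_def z_def e_def i_def p_def)
    then have q: "infinite_path (approx_tree e p) q"
      by (simp add: C_Cantor_char_fun[OF binary_tree_approx_tree inf])
    have "eval (bpair p q) (prog_decode i) n = Some (G (bpair r Q) n)" for n
    proof -
      have G: "G (bpair r Q) n = (LEAST v. v = w n \<or> halts (bpair p q) i n v (w n))"
        by (simp add: G_def Qqw p_def i_def)
      obtain v where v: "v < w n" "halts (bpair p q) i n v (w n)"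
        using covered_path[OF W_problem_signal[OF w] q] by blast
      have "G (bpair r Q) n = w n \<or> halts (bpair p q) i n (G (bpair r Q) n) (w n)"
        unfolding G by (rule LeastI[of _ "w n"]) simp
      moreover have "G (bpair r Q) n \<le> v" unfolding G by (rule Least_le) (simp add: v)
      \<comment> \<open>all values known at stage \<open>w n\<close> are below \<open>w n\<close>, so the default is not reached\<close>
      ultimately show ?thesis using v(1) halts_sound by auto
    qed
    then have "Phi i (bpair p q) = Some (G (bpair r Q))" by (simp add: Phi_Some_iff)
    then show ?thesis using path[OF q] by (auto simp: J)
  qed simp
  then show ?thesis
    unfolding weihrauch_le_def computable_def
    by (intro exI[of _ "Phi F'"] exI[of _ "Phi G'"]) (auto simp: F' G')
qed

text \<open>
  An instance \<open>x\<close> of the product is mapped to \<open>(e, i, x)\<close>, where \<open>e\<close> extracts the tree and \<open>i\<close>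
  attaches to a path \<open>q\<close> the increasing enumeration of the zeros of the second component. The
  functional \<open>i\<close> halts on \<open>(x, q)\<close> if there are infinitely many zeros. If moreover the tree is valid,
  then the tot-jump returns just the pairs consisting of a path and this enumeration. All other instances of the
  totalization accept every answer, and the tot-jump always has one.
\<close>

lemma totalization_C_Cantor_W_le: "totalization (C_Cantor \<times>\<^sub>W W_problem) \<le>\<^sub>W tot_jump C_Cantor"
proof -
  define A where "A = {X. infinite {s. bsnd (bfst X) s = 0}}"
  define nxt where "nxt X m = (LEAST s. m \<le> s \<and> bsnd (bfst X) s = 0)" for X m
  define w where "w X n = rec_nat (nxt X 0) (\<lambda>_ s. nxt X (Suc s)) n" for X :: baire and n
  have ex: "\<exists>s. m \<le> s \<and> bsnd (bfst X) s = 0" if "X \<in> A" for X m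
    using that unfolding A_def infinite_nat_iff_unbounded_le by blast
  have nxt: "m \<le> nxt X m \<and> bsnd (bfst X) (nxt X m) = 0" if "X \<in> A" for X m
    unfolding nxt_def by (rule LeastI_ex[OF ex[OF that]])
  have w: "w X \<in> W_problem (bsnd (bfst X))" if "X \<in> A" for X
  proof -
    have "bsnd (bfst X) (w X n) = 0" for n using nxt[OF that] by (cases n) (auto simp: w_def)
    moreover have "w X n < w X (Suc n)" for n
      using nxt[OF that, of "Suc (w X n)"] by (simp add: w_def Suc_le_eq)
    ultimately show ?thesis by (simp add: W_problem_def fun_eq_iff)
  qed
  have "rec_on A (\<lambda>X. bpair (bsnd X) (w X))"
    unfolding w_def nxt_def bpair_def bfst_def bsnd_def
    by (intro rec_intros) (use ex[unfolded bfst_def bsnd_def] in blast)+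
  then obtain i where i: "\<And>X. X \<in> A \<Longrightarrow> Phi i X = Some (bpair (bsnd X) (w X))"
    using computable_if_rec_on by blast
  have "rec_on UNIV bfst" unfolding bfst_def by (intro rec_intros)
  then obtain e where e: "\<And>X. Phi e X = Some (bfst X)"
    using computable_if_rec_on by blast
  have "rec_on UNIV (\<lambda>X n. if n = 0 then e else if n = 1 then i else X (n - 2))"
    by (intro rec_intros)
  moreover have "(\<lambda>n. if n = 0 then e else if n = 1 then i else X (n - 2)) = triple e i X" for X
    by (rule ext) (simp add: triple_def split: nat.split)
  ultimately obtain F' where F': "\<And>X. Phi F' X = Some (triple e i X)"
    using computable_if_rec_on[of UNIV "triple e i"] by auto
  have "rec_on UNIV bsnd" unfolding bsnd_def by (intro rec_intros)
  then obtain G' where G': "\<And>X. Phi G' X = Some (bsnd X)"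
    using computable_if_rec_on by blast
  have dom: "triple e i x \<in> pdom (tot_jump C_Cantor)" for x
    by (auto simp: pdom_def tot_jump_triple split: option.splits)
  have "y \<in> totalization (C_Cantor \<times>\<^sub>W W_problem) x"
    if y: "y \<in> tot_jump C_Cantor (triple e i x)" for x y
  proof (cases "x \<in> pdom (C_Cantor \<times>\<^sub>W W_problem)")
    case True
    then have C: "bfst x \<in> pdom C_Cantor" and W: "bsnd x \<in> pdom W_problem"
      using bpair_mem_pdom_parallel[of "bfst x" "bsnd x"] by simp_all
    have A: "bpair x q \<in> A" for q
    proof -
      from W obtain q where q: "\<forall>i. q (Suc i) > q i" "bsnd x \<circ> q = (\<lambda>_. 0)"
        by (auto simp: pdom_def W_problem_def)
      then have "inj q" by (metis strict_mono_Suc_iff strict_mono_imp_inj_on)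
      moreover have "range q \<subseteq> {s. bsnd x s = 0}" using q(2) by (auto simp: fun_eq_iff)
      ultimately show ?thesis
        unfolding A_def by (simp add: range_inj_infinite infinite_super)
    qed
    from y C obtain q where q: "q \<in> C_Cantor (bfst x)" "y = bpair q (w (bpair x q))"
      by (auto simp: tot_jump_triple e i[OF A])
    then show ?thesis
      using True w[OF A[of q]] by (auto simp: totalization_def parallel_def)
  qed (simp add: totalization_def)
  then show ?thesis
    unfolding weihrauch_le_def computable_def
    by (intro exI[of _ "Phi F'"] exI[of _ "Phi G'"]) (auto simp: F' G' dom)
qed

theorem theorem4p16:
  "tot_jump C_Cantor \<equiv>\<^sub>W totalization (C_Cantor \<times>\<^sub>W W_problem)"
  unfolding weihrauch_equiv_def using tot_jump_C_Cantor_le totalization_C_Cantor_W_le by blast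

end
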